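(* Let $\bar u^\pm,\bar n^\pm$ be constants and let $v^\pm,\rho^\pm,u^\pm,n^\pm,u^*,n^*,u^\sharp,n^\sharp$ be functions of $(x,t)$ as in the context, with $g_0=\frac{u^*-\bar u^-}{\bar u^+-\bar u^-}\in\mathscr G$ and $\tilde g_0=\frac{n^*-\bar n^-}{\bar n^+-\bar n^-}\in\mathscr G$. Suppose $g,\tilde g,g_1\in\mathscr G$ are such that $$u^\sharp-u^*-v^-(1-g)-v^+g=\mathscr R,\qquad n^\sharp-n^*-\rho^-(1-\tilde g)-\rho^+\tilde g=\mathscr R .\qquad(\ast)$$ Then: (i) For any $C^2$ function $f$, $$f(u^\sharp)-f(u^* )-(f(u^-)-f(\bar u^-))(1-g_1)-(f(u^+)-f(\bar u^+))g_1=\mathscr R,$$ $$f(u^\sharp)-f(u^-)(1-g_1)-f(u^+)g_1=\mathscr R_{\rm Sp},$$ and the left-hand side of the last identity equals $\mathscr R$ if $g_1=\dfrac{f(u^* )-f(\bar u^-)}{f(\bar u^+)-f(\bar u^-)}$. (ii) If the $x$-derivative of the error term in $(\ast)$ is still of the form $\mathscr R=\mathscr R_{\rm Ti}\mathscr R_{\rm Sp}$, then $$\partial_xu^\sharp-\partial_xu^*-\partial_xu^-(1-g_1)-\partial_xu^+g_1=\mathscr R.$$ (iii) For any $a,b\in\mathbb R$, $$an^\sharp+bu^\sharp-an^*-bu^*-(a\rho^-+bv^-)(1-g_1)-(a\rho^++bv^+)g_1=\mathscr R,$$ $$n^\sharp u^\sharp-n^*u^*-(n^-u^--\bar n^-\bar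 u^-)(1-g_1)-(n^+u^+-\bar n^+\bar u^+)g_1=\mathscr R.$$
   Context: Functions are of $(x,t)\in\mathbb R\times[0,\infty)$; $\nu>0$ and $\alpha>0$ are fixed parameters; $C$ denotes generic constants. **Classes of terms.** $\mathscr R_{\rm Ti}$ denotes a generic term with $\|\mathscr R_{\rm Ti}(\cdot,t)\|_{L^\infty}\le C\nu e^{-\alpha t}$. $\mathscr R_{\rm Sp}$ denotes a generic term with $\|\mathscr R_{\rm Sp}(\cdot,t)\|_{L^p}\le C(1+t)^{1/p}$ for every $1\le p<\infty$. $\mathscr R$ denotes a generic term of the form $\mathscr R=\mathscr R_{\rm Ti}\mathscr R_{\rm Sp}$ (so it decays exponentially in every $L^p$, $p<\infty$). "$F=\mathscr R$" (resp. $F=\mathscr R_{\rm Sp}$) means that $F$ is a term of that class. **Weights.** $\mathscr G$ is a family of regular bounded functions such that: if $g\in\mathscr G$ then $\lim_{x\to+\infty}g=1$, $\lim_{x\to-\infty}g=0$, and $(1-g)g$ and $\partial_xg$ are of class $\mathscr R_{\rm Sp}$; if $g_1,g_2\in\mathscr G$ then $(1-g_1)g_2$ and $g_1-g_2$ are of class $\mathscr R_{\rm Sp}$. **Functions.** $v^\pm,\partial_xv^\pm,\rho^\pm,\partial_x\rho^\pm$ are of class $\mathscr R_{\rm Ti}$; $u^\pm:=\bar u^\pm+v^\pm$, $n^\pm:=\bar n^\pm+\rho^\pm$. $u^*$ (resp. $n^*$) takes values between $\bar u^-$ and $\bar u^+$ (resp. $\bar n^-$ and $\bar n^+$) and tends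 to $\bar u^\pm$ (resp. $\bar n^\pm$) as $x\to\pm\infty$. $u^\sharp$ (resp. $n^\sharp$) takes values between $u^-$ and $u^+$ (resp. $n^-$ and $n^+$), and $u^\sharp\to u^\pm$ (resp. $n^\sharp\to n^\pm$) as $x\to\pm\infty$, i.e. the difference tends to $0$. *)

theory Defs
  imports "HOL-Probability.Probability"
begin

text \<open>
  A function of \<open>(x,t)\<close> on the half plane \<open>t \<ge> 0\<close> is rendered as a curried total function
  \<open>real \<Rightarrow> real \<Rightarrow> real\<close> with the space variable first. Every requirement below is restricted to
  \<open>t \<ge> 0\<close>, so the values at negative times are irrelevant.
\<close>

type_synonym field_xt = "real \<Rightarrow> real \<Rightarrow> real"

definition x_differentiable :: "field_xt \<Rightarrow> bool" where
  "x_differentiable F \<longleftrightarrow> (\<forall>t\<ge>0. \<forall>x. (\<lambda>y. F y t) differentiable (at x))"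

definition dx :: "field_xt \<Rightarrow> field_xt" where
  "dx F x t = deriv (\<lambda>y. F y t) x"


definition Linf_norm :: "(real \<Rightarrow> real) \<Rightarrow> ereal" where
  "Linf_norm h = esssup lebesgue (\<lambda>x. ereal \<bar>h x\<bar>)"

definition in_Lp :: "real \<Rightarrow> (real \<Rightarrow> real) \<Rightarrow> bool" where
  "in_Lp p h \<longleftrightarrow> h \<in> borel_measurable lebesgue \<and> integrable lebesgue (\<lambda>x. \<bar>h x\<bar> powr p)"

text \<open>Only meaningful for functions satisfying \<open>in_Lp p\<close>: the Bochner integral of a
  non-integrable function is \<open>0\<close>.\<close>

definition Lp_norm :: "real \<Rightarrow> (real \<Rightarrow> real) \<Rightarrow> real" where
  "Lp_norm p h = (LINT x|lebesgue. \<bar>h x\<bar> powr p) powr (1 / p)"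


text \<open>
  The three classes of terms \<open>\<R>\<^sub>T\<^sub>i\<close>, \<open>\<R>\<^sub>S\<^sub>p\<close> and \<open>\<R> = \<R>\<^sub>T\<^sub>i \<R>\<^sub>S\<^sub>p\<close>. The generic
  constant \<open>C\<close> never depends on \<open>t\<close>; in \<open>\<R>\<^sub>S\<^sub>p\<close> it may depend on \<open>p\<close>, so that a term
  of class \<open>\<R>\<^sub>S\<^sub>p\<close> need not be bounded (the exponent \<open>p = \<infinity>\<close> is excluded).
\<close>

definition class_Ti :: "real \<Rightarrow> real \<Rightarrow> field_xt \<Rightarrow> bool" where
  "class_Ti \<nu> \<alpha> F \<longleftrightarrow>
     (\<exists>C::real. \<forall>t\<ge>0. (\<lambda>x. F x t) \<in> borel_measurable lebesgue \<and>
        Linf_norm (\<lambda>x. F x t) \<le> ereal (C * \<nu> * exp (- (\<alpha> * t))))"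

definition class_Sp :: "field_xt \<Rightarrow> bool" where
  "class_Sp F \<longleftrightarrow>
     (\<forall>p\<ge>1. \<exists>C::real. \<forall>t\<ge>0. in_Lp p (\<lambda>x. F x t) \<and>
        Lp_norm p (\<lambda>x. F x t) \<le> C * (1 + t) powr (1 / p))"

definition class_R :: "real \<Rightarrow> real \<Rightarrow> field_xt \<Rightarrow> bool" where
  "class_R \<nu> \<alpha> F \<longleftrightarrow>
     (\<exists>A B. class_Ti \<nu> \<alpha> A \<and> class_Sp B \<and> (\<forall>x. \<forall>t\<ge>0. F x t = A x t * B x t))"


text \<open>
  \<open>\<G>\<close> is an arbitrary family with the stated properties, not a particular one. Of the
  regularity of its members only the existence of the \<open>x\<close>-derivative is required. Bounded means
  bounded in \<open>(x,t)\<close>; the limits are taken for each fixed \<open>t\<close>.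
\<close>

definition weight_family :: "field_xt set \<Rightarrow> bool" where
  "weight_family G \<longleftrightarrow>
     (\<forall>g\<in>G. x_differentiable g \<and>
            (\<exists>M. \<forall>x. \<forall>t\<ge>0. \<bar>g x t\<bar> \<le> M) \<and>
            (\<forall>t\<ge>0. ((\<lambda>x. g x t) \<longlongrightarrow> 1) at_top) \<and>
            (\<forall>t\<ge>0. ((\<lambda>x. g x t) \<longlongrightarrow> 0) at_bot) \<and>
            class_Sp (\<lambda>x t. (1 - g x t) * g x t) \<and>
            class_Sp (dx g)) \<and>
     (\<forall>g1\<in>G. \<forall>g2\<in>G. class_Sp (\<lambda>x t. (1 - g1 x t) * g2 x t) \<and>
                     class_Sp (\<lambda>x t. g1 x t - g2 x t))"


text \<open>\<open>v\<close> and its \<open>x\<close>-derivative are of class \<open>\<R>\<^sub>T\<^sub>i\<close>.\<close>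

definition perturbation :: "real \<Rightarrow> real \<Rightarrow> field_xt \<Rightarrow> bool" where
  "perturbation \<nu> \<alpha> v \<longleftrightarrow> x_differentiable v \<and> class_Ti \<nu> \<alpha> v \<and> class_Ti \<nu> \<alpha> (dx v)"

text \<open>
  \<open>w\<close> takes values between \<open>w\<^sub>-\<close> and \<open>w\<^sub>+\<close> (in either order) and the difference to
  \<open>w\<^sub>\<plusminus>\<close> tends to \<open>0\<close> as \<open>x \<rightarrow> \<plusminus>\<infinity>\<close>.
\<close>

definition connects :: "field_xt \<Rightarrow> field_xt \<Rightarrow> field_xt \<Rightarrow> bool" where
  "connects w wm wp \<longleftrightarrow>
     (\<forall>t\<ge>0. (\<forall>x. w x t \<in> closed_segment (wm x t) (wp x t)) \<and>
            ((\<lambda>x. w x t - wm x t) \<longlongrightarrow> 0) at_bot \<and>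
            ((\<lambda>x. w x t - wp x t) \<longlongrightarrow> 0) at_top)"

definition C2_function :: "(real \<Rightarrow> real) \<Rightarrow> bool" where
  "C2_function f \<longleftrightarrow>
     (\<exists>f'. (\<forall>x. (f has_real_derivative f' x) (at x)) \<and> f' C1_differentiable_on UNIV)"

end

theory Submission
  imports Defs
begin

text \<open>
  Since \<open>\<nu> > 0\<close>, a function is of class \<open>\<R>\<close> exactly when its product with \<open>exp (\<alpha> * t)\<close> is of class
  \<open>\<R>\<^sub>S\<^sub>p\<close>, so \<open>\<R>\<close> is closed under sums and under products with bounded functions. Two weights differ by
  an \<open>\<R>\<^sub>S\<^sub>p\<close> term, so all weights in \<open>(\<ast>)\<close> may be replaced by \<open>g\<^sub>1\<close>. Suppose that \<open>K\<close> is close to \<open>K\<^sub>\<plusminus>\<close>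
  at \<open>\<plusminus>\<infinity>\<close>, in the sense that \<open>(K - K\<^sub>-) (1 - g\<^sub>1)\<close> and \<open>(K - K\<^sub>+) g\<^sub>1\<close> are \<open>\<R>\<^sub>S\<^sub>p\<close>, and that
  \<open>H - h\<^sub>- (1 - g\<^sub>1) - h\<^sub>+ g\<^sub>1 = \<R>\<close> with \<open>h\<^sub>\<plusminus>\<close> of class \<open>\<R>\<^sub>T\<^sub>i\<close>; then the same relation holds for
  \<open>K H\<close> and \<open>K\<^sub>\<plusminus> h\<^sub>\<plusminus>\<close>. Apply this with \<open>H = u\<^sup>\<sharp> - u\<^sup>*\<close> and \<open>K = Q(u\<^sup>\<sharp>, u\<^sup>*)\<close>, where \<open>Q\<close> is the divided
  difference of \<open>f\<close>, which is locally Lipschitz because \<open>f\<close> is \<open>C\<^sup>2\<close>; and to both terms of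
  \<open>n\<^sup>\<sharp> u\<^sup>\<sharp> - n\<^sup>* u\<^sup>* = u\<^sup>\<sharp> (n\<^sup>\<sharp> - n\<^sup>*) + n\<^sup>* (u\<^sup>\<sharp> - u\<^sup>*)\<close>. Part (ii) is the product rule applied to \<open>(\<ast>)\<close>.
\<close>

definition class_Linf :: "field_xt \<Rightarrow> bool" where
  "class_Linf F \<longleftrightarrow>
     (\<exists>M. \<forall>t\<ge>0. (\<lambda>x. F x t) \<in> borel_measurable lebesgue \<and> (AE x in lebesgue. \<bar>F x t\<bar> \<le> M))"

lemma class_LinfI:
  assumes "\<And>t. t \<ge> 0 \<Longrightarrow> (\<lambda>x. F x t) \<in> borel_measurable lebesgue"
    and "\<And>t. t \<ge> 0 \<Longrightarrow> AE x in lebesgue. \<bar>F x t\<bar> \<le> M"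
  shows "class_Linf F"
  using assms unfolding class_Linf_def by blast

lemma class_LinfE:
  assumes "class_Linf F"
  obtains M where "M \<ge> 0" "\<And>t. t \<ge> 0 \<Longrightarrow> (\<lambda>x. F x t) \<in> borel_measurable lebesgue"
    "\<And>t. t \<ge> 0 \<Longrightarrow> AE x in lebesgue. \<bar>F x t\<bar> \<le> M"
proof -
  from assms obtain M where M: "\<And>t. t \<ge> 0 \<Longrightarrow> (\<lambda>x. F x t) \<in> borel_measurable lebesgue"
    "\<And>t. t \<ge> 0 \<Longrightarrow> AE x in lebesgue. \<bar>F x t\<bar> \<le> M"
    unfolding class_Linf_def by blast
  have "AE x in lebesgue. \<bar>F x t\<bar> \<le> max 0 M" if "t \<ge> 0" for t
    using M(2)[OF that] by eventually_elim auto
  then show ?thesis using that[of "max 0 M"] M(1) by auto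
qed

lemma class_Linf_const: "class_Linf (\<lambda>x t. c)"
  by (rule class_LinfI[where M = "\<bar>c\<bar>"]) auto

lemma class_Linf_add:
  assumes "class_Linf F" "class_Linf H"
  shows "class_Linf (\<lambda>x t. F x t + H x t)"
proof -
  obtain M where M: "\<And>t. t \<ge> 0 \<Longrightarrow> (\<lambda>x. F x t) \<in> borel_measurable lebesgue"
    "\<And>t. t \<ge> 0 \<Longrightarrow> AE x in lebesgue. \<bar>F x t\<bar> \<le> M" using assms(1) by (rule class_LinfE) blast
  obtain N where N: "\<And>t. t \<ge> 0 \<Longrightarrow> (\<lambda>x. H x t) \<in> borel_measurable lebesgue"
    "\<And>t. t \<ge> 0 \<Longrightarrow> AE x in lebesgue. \<bar>H x t\<bar> \<le> N" using assms(2) by (rule class_LinfE) blast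
  show ?thesis
  proof (rule class_LinfI[where M = "M + N"])
    fix t :: real assume t: "t \<ge> 0"
    show "(\<lambda>x. F x t + H x t) \<in> borel_measurable lebesgue"
      using M(1)[OF t] N(1)[OF t] by measurable
    show "AE x in lebesgue. \<bar>F x t + H x t\<bar> \<le> M + N"
      using M(2)[OF t] N(2)[OF t] by eventually_elim auto
  qed
qed

lemma class_Linf_mult:
  assumes "class_Linf F" "class_Linf H"
  shows "class_Linf (\<lambda>x t. F x t * H x t)"
proof -
  obtain M where M: "M \<ge> 0" "\<And>t. t \<ge> 0 \<Longrightarrow> (\<lambda>x. F x t) \<in> borel_measurable lebesgue"
    "\<And>t. t \<ge> 0 \<Longrightarrow> AE x in lebesgue. \<bar>F x t\<bar> \<le> M" using assms(1) by (rule class_LinfE) blast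
  obtain N where N: "\<And>t. t \<ge> 0 \<Longrightarrow> (\<lambda>x. H x t) \<in> borel_measurable lebesgue"
    "\<And>t. t \<ge> 0 \<Longrightarrow> AE x in lebesgue. \<bar>H x t\<bar> \<le> N" using assms(2) by (rule class_LinfE) blast
  show ?thesis
  proof (rule class_LinfI[where M = "M * N"])
    fix t :: real assume t: "t \<ge> 0"
    show "(\<lambda>x. F x t * H x t) \<in> borel_measurable lebesgue"
      using M(2)[OF t] N(1)[OF t] by measurable
    show "AE x in lebesgue. \<bar>F x t * H x t\<bar> \<le> M * N"
      using M(3)[OF t] N(2)[OF t] by eventually_elim (auto simp: abs_mult M(1) intro!: mult_mono)
  qed
qed

lemma class_Linf_diff:
  assumes "class_Linf F" "class_Linf H"
  shows "class_Linf (\<lambda>x t. F x t - H x t)"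
  using class_Linf_add[OF assms(1) class_Linf_mult[OF class_Linf_const[of "-1"] assms(2)]] by simp

lemma class_Sp_iff:
  "class_Sp F \<longleftrightarrow>
     (\<forall>p\<ge>1. \<exists>C. \<forall>t\<ge>0. (\<lambda>x. F x t) \<in> borel_measurable lebesgue \<and>
        integrable lebesgue (\<lambda>x. \<bar>F x t\<bar> powr p) \<and>
        (LINT x|lebesgue. \<bar>F x t\<bar> powr p) \<le> C * (1 + t))" (is "_ \<longleftrightarrow> ?R")
proof
  assume L: "class_Sp F"
  show ?R
  proof (intro allI impI)
    fix p :: real assume p: "p \<ge> 1"
    obtain C where C: "\<And>t. t \<ge> 0 \<Longrightarrow> in_Lp p (\<lambda>x. F x t)"
      "\<And>t. t \<ge> 0 \<Longrightarrow> Lp_norm p (\<lambda>x. F x t) \<le> C * (1 + t) powr (1 / p)"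
      using L p unfolding class_Sp_def by blast
    have "(LINT x|lebesgue. \<bar>F x t\<bar> powr p) \<le> \<bar>C\<bar> powr p * (1 + t)" if t: "t \<ge> 0" for t
    proof -
      let ?I = "LINT x|lebesgue. \<bar>F x t\<bar> powr p"
      have I: "?I \<ge> 0" by (rule integral_nonneg_AE) auto
      have "?I powr (1 / p) \<le> C * (1 + t) powr (1 / p)" using C(2)[OF t] by (simp add: Lp_norm_def)
      also have "\<dots> \<le> \<bar>C\<bar> * (1 + t) powr (1 / p)" by (intro mult_right_mono) auto
      finally have "(?I powr (1 / p)) powr p \<le> (\<bar>C\<bar> * (1 + t) powr (1 / p)) powr p"
        using p by (intro powr_mono2) auto
      then show ?thesis using p t I by (simp add: powr_powr powr_mult)
    qed
    then show "\<exists>C. \<forall>t\<ge>0. (\<lambda>x. F x t) \<in> borel_measurable lebesgue \<and>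
        integrable lebesgue (\<lambda>x. \<bar>F x t\<bar> powr p) \<and>
        (LINT x|lebesgue. \<bar>F x t\<bar> powr p) \<le> C * (1 + t)"
      using C(1) unfolding in_Lp_def by blast
  qed
next
  assume R: ?R
  show "class_Sp F" unfolding class_Sp_def
  proof (intro allI impI)
    fix p :: real assume p: "p \<ge> 1"
    obtain C where C: "\<And>t. t \<ge> 0 \<Longrightarrow> in_Lp p (\<lambda>x. F x t)"
      "\<And>t. t \<ge> 0 \<Longrightarrow> (LINT x|lebesgue. \<bar>F x t\<bar> powr p) \<le> C * (1 + t)"
      using R p unfolding in_Lp_def by blast
    have "Lp_norm p (\<lambda>x. F x t) \<le> \<bar>C\<bar> powr (1 / p) * (1 + t) powr (1 / p)" if t: "t \<ge> 0" for t
    proof -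
      have I: "(LINT x|lebesgue. \<bar>F x t\<bar> powr p) \<ge> 0" by (rule integral_nonneg_AE) auto
      have "C * (1 + t) \<le> \<bar>C\<bar> * (1 + t)" using t by (intro mult_right_mono) auto
      with C(2)[OF t] have "(LINT x|lebesgue. \<bar>F x t\<bar> powr p) \<le> \<bar>C\<bar> * (1 + t)" by linarith
      then have "Lp_norm p (\<lambda>x. F x t) \<le> (\<bar>C\<bar> * (1 + t)) powr (1 / p)"
        unfolding Lp_norm_def using p I by (intro powr_mono2) auto
      then show ?thesis using t by (simp add: powr_mult)
    qed
    then show "\<exists>C. \<forall>t\<ge>0. in_Lp p (\<lambda>x. F x t) \<and> Lp_norm p (\<lambda>x. F x t) \<le> C * (1 + t) powr (1 / p)"
      using C(1) by blast
  qed
qed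

lemma class_Sp_measurable:
  "class_Sp F \<Longrightarrow> t \<ge> 0 \<Longrightarrow> (\<lambda>x. F x t) \<in> borel_measurable lebesgue"
  unfolding class_Sp_iff by (metis order_refl)

lemma class_Sp_dominated:
  assumes B: "class_Sp B"
    and meas: "\<And>t. t \<ge> 0 \<Longrightarrow> (\<lambda>x. F x t) \<in> borel_measurable lebesgue"
    and le: "\<And>t. t \<ge> 0 \<Longrightarrow> AE x in lebesgue. \<bar>F x t\<bar> \<le> K * \<bar>B x t\<bar>"
  shows "class_Sp F"
  unfolding class_Sp_iff
proof (intro allI impI)
  fix p :: real assume p: "p \<ge> 1"
  obtain C where C: "\<And>t. t \<ge> 0 \<Longrightarrow> integrable lebesgue (\<lambda>x. \<bar>B x t\<bar> powr p)"
    "\<And>t. t \<ge> 0 \<Longrightarrow> (LINT x|lebesgue. \<bar>B x t\<bar> powr p) \<le> C * (1 + t)"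
    using B p unfolding class_Sp_iff by blast
  have "integrable lebesgue (\<lambda>x. \<bar>F x t\<bar> powr p) \<and>
        (LINT x|lebesgue. \<bar>F x t\<bar> powr p) \<le> (\<bar>K\<bar> powr p * C) * (1 + t)" if t: "t \<ge> 0" for t
  proof -
    have ae: "AE x in lebesgue. \<bar>F x t\<bar> powr p \<le> \<bar>K\<bar> powr p * \<bar>B x t\<bar> powr p"
      using le[OF t]
    proof eventually_elim
      case (elim x)
      have "K * \<bar>B x t\<bar> \<le> \<bar>K\<bar> * \<bar>B x t\<bar>" by (intro mult_right_mono) auto
      with elim have "\<bar>F x t\<bar> powr p \<le> (\<bar>K\<bar> * \<bar>B x t\<bar>) powr p"
        using p by (intro powr_mono2) auto
      then show ?case by (simp add: powr_mult)
    qed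
    have ib: "integrable lebesgue (\<lambda>x. \<bar>K\<bar> powr p * \<bar>B x t\<bar> powr p)"
      using C(1)[OF t] by simp
    have i: "integrable lebesgue (\<lambda>x. \<bar>F x t\<bar> powr p)"
      by (rule Bochner_Integration.integrable_bound[OF ib])
        (use meas[OF t] ae in \<open>auto simp: abs_mult\<close>)
    have "(LINT x|lebesgue. \<bar>F x t\<bar> powr p) \<le> (LINT x|lebesgue. \<bar>K\<bar> powr p * \<bar>B x t\<bar> powr p)"
      by (rule integral_mono_AE[OF i ib ae])
    also have "\<dots> = \<bar>K\<bar> powr p * (LINT x|lebesgue. \<bar>B x t\<bar> powr p)" by simp
    also have "\<dots> \<le> \<bar>K\<bar> powr p * (C * (1 + t))" by (intro mult_left_mono C(2) t) auto
    finally show ?thesis using i by (simp add: mult.assoc)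
  qed
  then show "\<exists>C. \<forall>t\<ge>0. (\<lambda>x. F x t) \<in> borel_measurable lebesgue \<and>
        integrable lebesgue (\<lambda>x. \<bar>F x t\<bar> powr p) \<and>
        (LINT x|lebesgue. \<bar>F x t\<bar> powr p) \<le> C * (1 + t)"
    using meas by blast
qed

lemma powr_abs_add_le:
  fixes a b p :: real
  assumes "p \<ge> 0"
  shows "\<bar>a + b\<bar> powr p \<le> 2 powr p * (\<bar>a\<bar> powr p + \<bar>b\<bar> powr p)"
proof -
  have "\<bar>a + b\<bar> powr p \<le> (2 * max \<bar>a\<bar> \<bar>b\<bar>) powr p" using assms by (intro powr_mono2) auto
  also have "\<dots> = 2 powr p * max \<bar>a\<bar> \<bar>b\<bar> powr p" by (simp add: powr_mult)
  also have "\<dots> \<le> 2 powr p * (\<bar>a\<bar> powr p + \<bar>b\<bar> powr p)" by (intro mult_left_mono) (auto simp: max_def)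
  finally show ?thesis .
qed

lemma class_Sp_add:
  assumes "class_Sp F" "class_Sp H"
  shows "class_Sp (\<lambda>x t. F x t + H x t)"
  unfolding class_Sp_iff
proof (intro allI impI)
  fix p :: real assume p: "p \<ge> 1"
  obtain C where C: "\<And>t. t \<ge> 0 \<Longrightarrow> integrable lebesgue (\<lambda>x. \<bar>F x t\<bar> powr p)"
    "\<And>t. t \<ge> 0 \<Longrightarrow> (LINT x|lebesgue. \<bar>F x t\<bar> powr p) \<le> C * (1 + t)"
    using assms(1) p unfolding class_Sp_iff by blast
  obtain D where D: "\<And>t. t \<ge> 0 \<Longrightarrow> integrable lebesgue (\<lambda>x. \<bar>H x t\<bar> powr p)"
    "\<And>t. t \<ge> 0 \<Longrightarrow> (LINT x|lebesgue. \<bar>H x t\<bar> powr p) \<le> D * (1 + t)"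
    using assms(2) p unfolding class_Sp_iff by blast
  have "(\<lambda>x. F x t + H x t) \<in> borel_measurable lebesgue \<and>
        integrable lebesgue (\<lambda>x. \<bar>F x t + H x t\<bar> powr p) \<and>
        (LINT x|lebesgue. \<bar>F x t + H x t\<bar> powr p) \<le> (2 powr p * (C + D)) * (1 + t)"
    if t: "t \<ge> 0" for t
  proof -
    have m: "(\<lambda>x. F x t + H x t) \<in> borel_measurable lebesgue"
      using class_Sp_measurable[OF assms(1) t] class_Sp_measurable[OF assms(2) t] by measurable
    have le: "\<bar>F x t + H x t\<bar> powr p \<le> 2 powr p * (\<bar>F x t\<bar> powr p + \<bar>H x t\<bar> powr p)" for x
      using p by (intro powr_abs_add_le) auto
    have ib: "integrable lebesgue (\<lambda>x. 2 powr p * (\<bar>F x t\<bar> powr p + \<bar>H x t\<bar> powr p))"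
      using C(1)[OF t] D(1)[OF t] by simp
    have i: "integrable lebesgue (\<lambda>x. \<bar>F x t + H x t\<bar> powr p)"
      by (rule Bochner_Integration.integrable_bound[OF ib])
        (use m le in \<open>auto simp: abs_mult\<close>)
    have "(LINT x|lebesgue. \<bar>F x t + H x t\<bar> powr p)
        \<le> (LINT x|lebesgue. 2 powr p * (\<bar>F x t\<bar> powr p + \<bar>H x t\<bar> powr p))"
      by (rule integral_mono[OF i ib le])
    also have "\<dots> = 2 powr p * ((LINT x|lebesgue. \<bar>F x t\<bar> powr p) + (LINT x|lebesgue. \<bar>H x t\<bar> powr p))"
      using C(1)[OF t] D(1)[OF t] by simp
    also have "\<dots> \<le> 2 powr p * (C * (1 + t) + D * (1 + t))"
      by (intro mult_left_mono add_mono C(2) D(2) t) auto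
    finally show ?thesis using i m by (simp add: algebra_simps)
  qed
  then show "\<exists>C. \<forall>t\<ge>0. (\<lambda>x. F x t + H x t) \<in> borel_measurable lebesgue \<and>
        integrable lebesgue (\<lambda>x. \<bar>F x t + H x t\<bar> powr p) \<and>
        (LINT x|lebesgue. \<bar>F x t + H x t\<bar> powr p) \<le> C * (1 + t)"
    by blast
qed

lemma class_Sp_Linf_mult:
  assumes "class_Linf F" "class_Sp H"
  shows "class_Sp (\<lambda>x t. F x t * H x t)"
proof -
  obtain M where M: "\<And>t. t \<ge> 0 \<Longrightarrow> (\<lambda>x. F x t) \<in> borel_measurable lebesgue"
    "\<And>t. t \<ge> 0 \<Longrightarrow> AE x in lebesgue. \<bar>F x t\<bar> \<le> M" using assms(1) by (rule class_LinfE) blast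
  show ?thesis
  proof (rule class_Sp_dominated[OF assms(2), where K = M])
    fix t :: real assume t: "t \<ge> 0"
    show "(\<lambda>x. F x t * H x t) \<in> borel_measurable lebesgue"
      using M(1)[OF t] class_Sp_measurable[OF assms(2) t] by measurable
    show "AE x in lebesgue. \<bar>F x t * H x t\<bar> \<le> M * \<bar>H x t\<bar>"
      using M(2)[OF t] by eventually_elim (auto simp: abs_mult intro!: mult_right_mono)
  qed
qed

lemma class_Sp_cong:
  assumes "class_Sp F" "\<And>x t. t \<ge> 0 \<Longrightarrow> H x t = F x t"
  shows "class_Sp H"
  using assms unfolding class_Sp_iff by simp

lemma class_Ti_iff:
  assumes "\<nu> > 0"
  shows "class_Ti \<nu> \<alpha> F \<longleftrightarrow> class_Linf (\<lambda>x t. exp (\<alpha> * t) * F x t)"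
proof
  assume "class_Ti \<nu> \<alpha> F"
  then obtain C where C: "\<And>t. t \<ge> 0 \<Longrightarrow> (\<lambda>x. F x t) \<in> borel_measurable lebesgue"
    "\<And>t. t \<ge> 0 \<Longrightarrow> Linf_norm (\<lambda>x. F x t) \<le> ereal (C * \<nu> * exp (- (\<alpha> * t)))"
    unfolding class_Ti_def by blast
  show "class_Linf (\<lambda>x t. exp (\<alpha> * t) * F x t)"
  proof (rule class_LinfI[where M = "C * \<nu>"])
    fix t :: real assume t: "t \<ge> 0"
    show "(\<lambda>x. exp (\<alpha> * t) * F x t) \<in> borel_measurable lebesgue" using C(1)[OF t] by measurable
    have "AE x in lebesgue. ereal \<bar>F x t\<bar> \<le> Linf_norm (\<lambda>x. F x t)"
      unfolding Linf_norm_def by (rule esssup_AE)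
    then show "AE x in lebesgue. \<bar>exp (\<alpha> * t) * F x t\<bar> \<le> C * \<nu>"
    proof eventually_elim
      case (elim x)
      then have "ereal \<bar>F x t\<bar> \<le> ereal (C * \<nu> * exp (- (\<alpha> * t)))"
        using C(2)[OF t] order_trans by blast
      then show ?case by (simp add: abs_mult exp_minus field_simps)
    qed
  qed
next
  assume "class_Linf (\<lambda>x t. exp (\<alpha> * t) * F x t)"
  then obtain M where M: "\<And>t. t \<ge> 0 \<Longrightarrow> (\<lambda>x. exp (\<alpha> * t) * F x t) \<in> borel_measurable lebesgue"
    "\<And>t. t \<ge> 0 \<Longrightarrow> AE x in lebesgue. \<bar>exp (\<alpha> * t) * F x t\<bar> \<le> M" by (rule class_LinfE) auto
  have "(\<lambda>x. F x t) \<in> borel_measurable lebesgue \<and>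
      Linf_norm (\<lambda>x. F x t) \<le> ereal (M / \<nu> * \<nu> * exp (- (\<alpha> * t)))" if t: "t \<ge> 0" for t
  proof
    have "(\<lambda>x. exp (- (\<alpha> * t)) * (exp (\<alpha> * t) * F x t)) \<in> borel_measurable lebesgue"
      using M(1)[OF t] by measurable
    then show m: "(\<lambda>x. F x t) \<in> borel_measurable lebesgue" by (simp flip: exp_add mult.assoc)
    show "Linf_norm (\<lambda>x. F x t) \<le> ereal (M / \<nu> * \<nu> * exp (- (\<alpha> * t)))"
      unfolding Linf_norm_def
    proof (rule esssup_I)
      show "(\<lambda>x. ereal \<bar>F x t\<bar>) \<in> borel_measurable lebesgue" using m by measurable
      show "AE x in lebesgue. ereal \<bar>F x t\<bar> \<le> ereal (M / \<nu> * \<nu> * exp (- (\<alpha> * t)))"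
        using M(2)[OF t] by eventually_elim
          (use assms in \<open>simp add: abs_mult exp_minus field_simps\<close>)
    qed
  qed
  then show "class_Ti \<nu> \<alpha> F" unfolding class_Ti_def by blast
qed

lemma class_R_iff:
  assumes "\<nu> > 0"
  shows "class_R \<nu> \<alpha> F \<longleftrightarrow> class_Sp (\<lambda>x t. exp (\<alpha> * t) * F x t)"
proof
  assume "class_R \<nu> \<alpha> F"
  then obtain A B where AB: "class_Ti \<nu> \<alpha> A" "class_Sp B" "\<And>x t. t \<ge> 0 \<Longrightarrow> F x t = A x t * B x t"
    unfolding class_R_def by blast
  have "class_Sp (\<lambda>x t. (exp (\<alpha> * t) * A x t) * B x t)"
    using AB assms by (intro class_Sp_Linf_mult) (auto simp: class_Ti_iff)
  then show "class_Sp (\<lambda>x t. exp (\<alpha> * t) * F x t)"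
    by (rule class_Sp_cong) (simp add: AB(3))
next
  assume *: "class_Sp (\<lambda>x t. exp (\<alpha> * t) * F x t)"
  have "class_Ti \<nu> \<alpha> (\<lambda>x t. exp (- (\<alpha> * t)))"
    using class_Linf_const[of 1] assms by (simp add: class_Ti_iff flip: exp_add)
  with * show "class_R \<nu> \<alpha> F"
    unfolding class_R_def by (intro exI conjI) (assumption, assumption, simp flip: exp_add mult.assoc)
qed

lemma class_R_cong:
  assumes "class_R \<nu> \<alpha> F" "\<And>x t. t \<ge> 0 \<Longrightarrow> H x t = F x t"
  shows "class_R \<nu> \<alpha> H"
  using assms unfolding class_R_def by simp

lemma class_R_Ti_Sp_mult: "class_Ti \<nu> \<alpha> A \<Longrightarrow> class_Sp B \<Longrightarrow> class_R \<nu> \<alpha> (\<lambda>x t. A x t * B x t)"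
  unfolding class_R_def by blast

lemma class_R_add:
  assumes "\<nu> > 0" "class_R \<nu> \<alpha> F" "class_R \<nu> \<alpha> H"
  shows "class_R \<nu> \<alpha> (\<lambda>x t. F x t + H x t)"
  using class_Sp_add assms by (fastforce simp: class_R_iff distrib_left)

lemma class_R_Linf_mult:
  assumes "\<nu> > 0" "class_Linf K" "class_R \<nu> \<alpha> F"
  shows "class_R \<nu> \<alpha> (\<lambda>x t. K x t * F x t)"
  using class_Sp_Linf_mult[of K "\<lambda>x t. exp (\<alpha> * t) * F x t"] assms
  by (simp add: class_R_iff mult.left_commute)

lemma class_Ti_diff:
  assumes "\<nu> > 0" "class_Ti \<nu> \<alpha> F" "class_Ti \<nu> \<alpha> H"
  shows "class_Ti \<nu> \<alpha> (\<lambda>x t. F x t - H x t)"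
  using class_Linf_diff assms by (fastforce simp: class_Ti_iff right_diff_distrib)

lemma class_Linf_exp_decay:
  assumes "\<alpha> > 0"
  shows "class_Linf (\<lambda>x t. exp (- (\<alpha> * t)))"
  by (rule class_LinfI[where M = 1]) (use assms in auto)

lemma class_Ti_imp_Linf:
  assumes "\<nu> > 0" "\<alpha> > 0" "class_Ti \<nu> \<alpha> F"
  shows "class_Linf F"
  using class_Linf_mult[OF class_Linf_exp_decay[OF assms(2)], of "\<lambda>x t. exp (\<alpha> * t) * F x t"] assms
  by (simp add: class_Ti_iff flip: exp_add mult.assoc)

lemma class_R_imp_Sp:
  assumes "\<nu> > 0" "\<alpha> > 0" "class_R \<nu> \<alpha> F"
  shows "class_Sp F"
  using class_Sp_Linf_mult[OF class_Linf_exp_decay[OF assms(2)], of "\<lambda>x t. exp (\<alpha> * t) * F x t"] assms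
  by (simp add: class_R_iff flip: exp_add mult.assoc)

definition interpolates :: "field_xt \<Rightarrow> field_xt \<Rightarrow> field_xt \<Rightarrow> field_xt \<Rightarrow> bool" where
  "interpolates w K Km Kp \<longleftrightarrow>
     class_Sp (\<lambda>x t. (K x t - Km x t) * (1 - w x t)) \<and> class_Sp (\<lambda>x t. (K x t - Kp x t) * w x t)"

lemma interpolates_imp_Sp:
  assumes "interpolates w K Km Kp"
  shows "class_Sp (\<lambda>x t. K x t - Km x t * (1 - w x t) - Kp x t * w x t)"
  by (rule class_Sp_cong[OF class_Sp_add[OF conjunct1 conjunct2]])
    (use assms in \<open>auto simp: interpolates_def algebra_simps\<close>)

lemma class_R_interpolates_mult:
  assumes nu: "\<nu> > 0" and K: "class_Linf K" and ip: "interpolates w K Km Kp"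
    and H: "class_Ti \<nu> \<alpha> Hm" "class_Ti \<nu> \<alpha> Hp"
      "class_R \<nu> \<alpha> (\<lambda>x t. H x t - Hm x t * (1 - w x t) - Hp x t * w x t)"
  shows "class_R \<nu> \<alpha> (\<lambda>x t. K x t * H x t - Km x t * Hm x t * (1 - w x t) - Kp x t * Hp x t * w x t)"
proof -
  have "class_R \<nu> \<alpha> (\<lambda>x t. K x t * (H x t - Hm x t * (1 - w x t) - Hp x t * w x t)
      + (Hm x t * ((K x t - Km x t) * (1 - w x t)) + Hp x t * ((K x t - Kp x t) * w x t)))"
    using ip unfolding interpolates_def
    by (intro class_R_add class_R_Linf_mult class_R_Ti_Sp_mult nu K H) auto
  then show ?thesis by (rule class_R_cong) (simp add: algebra_simps)
qed

definition box_Lipschitz :: "(real \<Rightarrow> real \<Rightarrow> real) \<Rightarrow> bool" where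
  "box_Lipschitz Q \<longleftrightarrow>
     (\<forall>M. \<exists>L\<ge>0. \<forall>a\<in>{-M..M}. \<forall>b\<in>{-M..M}. \<forall>c\<in>{-M..M}. \<forall>d\<in>{-M..M}.
        \<bar>Q a b - Q c d\<bar> \<le> L * (\<bar>a - c\<bar> + \<bar>b - d\<bar>))"

lemma box_LipschitzE:
  assumes "box_Lipschitz Q"
  obtains L where "L \<ge> 0" "\<And>a b c d. \<bar>a\<bar> \<le> M \<Longrightarrow> \<bar>b\<bar> \<le> M \<Longrightarrow> \<bar>c\<bar> \<le> M \<Longrightarrow> \<bar>d\<bar> \<le> M \<Longrightarrow>
    \<bar>Q a b - Q c d\<bar> \<le> L * (\<bar>a - c\<bar> + \<bar>b - d\<bar>)"
proof -
  obtain L where "L \<ge> 0" "\<forall>a\<in>{-M..M}. \<forall>b\<in>{-M..M}. \<forall>c\<in>{-M..M}. \<forall>d\<in>{-M..M}.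
      \<bar>Q a b - Q c d\<bar> \<le> L * (\<bar>a - c\<bar> + \<bar>b - d\<bar>)"
    using assms unfolding box_Lipschitz_def by blast
  then show ?thesis by (intro that[of L]) (auto simp: abs_le_iff)
qed

lemma C2_divided_difference:
  assumes "C2_function f"
  obtains Q :: "real \<Rightarrow> real \<Rightarrow> real"
  where "case_prod Q \<in> borel_measurable (borel \<Otimes>\<^sub>M borel)"
    and "\<And>a b. f a - f b = Q a b * (a - b)"
    and "box_Lipschitz Q"
proof -
  obtain f' where f': "\<And>x. (f has_real_derivative f' x) (at x)" and C1: "f' C1_differentiable_on UNIV"
    using assms unfolding C2_function_def by blast
  obtain D where D: "\<And>x. (f' has_real_derivative D x) (at x)" "continuous_on UNIV D"
    using C1 unfolding C1_differentiable_on_def has_real_derivative_iff_has_vector_derivative by auto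
  have cf: "continuous_on UNIV f" "continuous_on UNIV f'"
    using f' D(1) by (meson DERIV_isCont continuous_at_imp_continuous_on)+
  define Q where "Q a b = (if a = b then f' a else (f a - f b) / (a - b))" for a b
  \<comment> \<open>\<open>k a b\<close> is a primitive of \<open>s \<mapsto> f' (b + s * (a - b))\<close>, so the mean value theorem applied to
    \<open>k a b - k c d\<close> evaluates both derivatives at the same parameter \<open>s\<close>.\<close>
  define k where "k a b s = (if a = b then s * f' a else f (b + s * (a - b)) / (a - b))" for a b s
  have Qk: "Q a b = k a b 1 - k a b 0" for a b
    by (simp add: Q_def k_def diff_divide_distrib)
  have dk: "(k a b has_real_derivative f' (b + s * (a - b))) (at s)" for a b s
  proof (cases "a = b")
    case True
    then show ?thesis unfolding k_def by (auto intro!: derivative_eq_intros)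
  next
    case False
    have "((\<lambda>s. f (b + s * (a - b))) has_real_derivative f' (b + s * (a - b)) * (a - b)) (at s)"
      by (rule DERIV_chain2[OF f']) (auto intro!: derivative_eq_intros)
    from DERIV_cdivide[OF this, of "a - b"] False show ?thesis unfolding k_def by simp
  qed
  show ?thesis
  proof (rule that[of Q])
    have [measurable]: "f \<in> borel_measurable borel" "f' \<in> borel_measurable borel"
      using cf by (auto intro: borel_measurable_continuous_onI)
    show "case_prod Q \<in> borel_measurable (borel \<Otimes>\<^sub>M borel)" unfolding Q_def by measurable
    show "f a - f b = Q a b * (a - b)" for a b by (simp add: Q_def)
  next
    show "box_Lipschitz Q"
      unfolding box_Lipschitz_def
    proof
      fix M :: real
      have "bounded (D ` {-M..M})"
        by (intro compact_imp_bounded compact_continuous_image continuous_on_subset[OF D(2)]) auto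
      then obtain L where L: "\<And>x. x \<in> {-M..M} \<Longrightarrow> \<bar>D x\<bar> \<le> L"
        unfolding bounded_iff by (metis imageI real_norm_def)
      have lip: "\<bar>f' x - f' y\<bar> \<le> L * \<bar>x - y\<bar>" if "x \<in> {-M..M}" "y \<in> {-M..M}" for x y
        using field_differentiable_bound[of "{-M..M}" f' D L x y] that D(1) L
        by (auto intro: DERIV_subset)
      have "\<bar>Q a b - Q c d\<bar> \<le> \<bar>L\<bar> * (\<bar>a - c\<bar> + \<bar>b - d\<bar>)"
        if in_M: "a \<in> {-M..M}" "b \<in> {-M..M}" "c \<in> {-M..M}" "d \<in> {-M..M}" for a b c d
      proof -
        let ?h = "\<lambda>s. k a b s - k c d s"
        have "\<exists>s>0. s < 1 \<and> ?h 1 - ?h 0 = (1 - 0) * (f' (b + s * (a - b)) - f' (d + s * (c - d)))"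
          by (rule MVT2) (auto intro: DERIV_diff dk)
        then obtain s where s: "0 < s" "s < 1"
          and eq: "Q a b - Q c d = f' (b + s * (a - b)) - f' (d + s * (c - d))"
          by (auto simp: Qk)
        have conv: "y + s * (x - y) \<in> {-M..M}" if "x \<in> {-M..M}" "y \<in> {-M..M}" for x y
          using convexD_alt[of "{-M..M}" y x s] that s by (simp add: algebra_simps)
        have "\<bar>Q a b - Q c d\<bar> \<le> L * \<bar>(b + s * (a - b)) - (d + s * (c - d))\<bar>"
          unfolding eq by (intro lip conv in_M)
        also have "\<dots> \<le> \<bar>L\<bar> * \<bar>(b + s * (a - b)) - (d + s * (c - d))\<bar>" by (intro mult_right_mono) auto
        also have "(b + s * (a - b)) - (d + s * (c - d)) = s * (a - c) + (1 - s) * (b - d)"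
          by (simp add: algebra_simps)
        also have "\<bar>s * (a - c) + (1 - s) * (b - d)\<bar> \<le> s * \<bar>a - c\<bar> + (1 - s) * \<bar>b - d\<bar>"
          using s abs_triangle_ineq[of "s * (a - c)" "(1 - s) * (b - d)"] by (simp add: abs_mult)
        also have "\<dots> \<le> 1 * \<bar>a - c\<bar> + 1 * \<bar>b - d\<bar>" using s by (intro add_mono mult_right_mono) auto
        finally show ?thesis by (simp add: mult_left_mono)
      qed
      then show "\<exists>L\<ge>0. \<forall>a\<in>{-M..M}. \<forall>b\<in>{-M..M}. \<forall>c\<in>{-M..M}. \<forall>d\<in>{-M..M}.
             \<bar>Q a b - Q c d\<bar> \<le> L * (\<bar>a - c\<bar> + \<bar>b - d\<bar>)"
        by (intro exI[of _ "\<bar>L\<bar>"]) auto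
    qed
  qed
qed

lemma AE_abs_le_common_bound:
  assumes "class_Linf a" "class_Linf b" "class_Linf c" "class_Linf d"
  obtains M where "\<And>t. t \<ge> 0 \<Longrightarrow>
    AE x in lebesgue. \<bar>a x t\<bar> \<le> M \<and> \<bar>b x t\<bar> \<le> M \<and> \<bar>c x t\<bar> \<le> M \<and> \<bar>d x t\<bar> \<le> M"
proof -
  obtain A where A: "\<And>t. t \<ge> 0 \<Longrightarrow> AE x in lebesgue. \<bar>a x t\<bar> \<le> A"
    using assms(1) by (rule class_LinfE) blast
  obtain B where B: "\<And>t. t \<ge> 0 \<Longrightarrow> AE x in lebesgue. \<bar>b x t\<bar> \<le> B"
    using assms(2) by (rule class_LinfE) blast
  obtain C where C: "\<And>t. t \<ge> 0 \<Longrightarrow> AE x in lebesgue. \<bar>c x t\<bar> \<le> C"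
    using assms(3) by (rule class_LinfE) blast
  obtain D where D: "\<And>t. t \<ge> 0 \<Longrightarrow> AE x in lebesgue. \<bar>d x t\<bar> \<le> D"
    using assms(4) by (rule class_LinfE) blast
  show ?thesis
  proof (rule that[of "max (max A B) (max C D)"])
    fix t :: real assume "t \<ge> 0"
    from A[OF this] B[OF this] C[OF this] D[OF this]
    show "AE x in lebesgue. \<bar>a x t\<bar> \<le> max (max A B) (max C D) \<and> \<bar>b x t\<bar> \<le> max (max A B) (max C D) \<and>
        \<bar>c x t\<bar> \<le> max (max A B) (max C D) \<and> \<bar>d x t\<bar> \<le> max (max A B) (max C D)"
      by eventually_elim (auto simp: max_def)
  qed
qed

lemma class_Linf_measurable:
  "class_Linf F \<Longrightarrow> t \<ge> 0 \<Longrightarrow> (\<lambda>x. F x t) \<in> borel_measurable lebesgue"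
  unfolding class_Linf_def by blast

lemma borel_measurable_compose2:
  assumes "case_prod Q \<in> borel_measurable (borel \<Otimes>\<^sub>M borel)"
    and "class_Linf a" "class_Linf b" "t \<ge> 0"
  shows "(\<lambda>x. Q (a x t) (b x t)) \<in> borel_measurable lebesgue"
proof -
  have "(\<lambda>x. (a x t, b x t)) \<in> lebesgue \<rightarrow>\<^sub>M borel \<Otimes>\<^sub>M borel"
    using assms(2-4) by (intro measurable_Pair class_Linf_measurable)
  from measurable_compose[OF this assms(1)] show ?thesis by simp
qed

lemma class_Linf_compose2:
  assumes Q: "case_prod Q \<in> borel_measurable (borel \<Otimes>\<^sub>M borel)" "box_Lipschitz Q"
    and ab: "class_Linf a" "class_Linf b"
  shows "class_Linf (\<lambda>x t. Q (a x t) (b x t))"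
proof -
  obtain M where M: "\<And>t. t \<ge> 0 \<Longrightarrow>
      AE x in lebesgue. \<bar>a x t\<bar> \<le> M \<and> \<bar>b x t\<bar> \<le> M \<and> \<bar>0\<bar> \<le> M \<and> \<bar>0\<bar> \<le> M"
    by (rule AE_abs_le_common_bound[OF ab class_Linf_const[of 0] class_Linf_const[of 0]]) (rule that)
  obtain L where L: "L \<ge> 0" "\<And>a b c d. \<bar>a\<bar> \<le> M \<Longrightarrow> \<bar>b\<bar> \<le> M \<Longrightarrow> \<bar>c\<bar> \<le> M \<Longrightarrow> \<bar>d\<bar> \<le> M \<Longrightarrow>
      \<bar>Q a b - Q c d\<bar> \<le> L * (\<bar>a - c\<bar> + \<bar>b - d\<bar>)"
    by (rule box_LipschitzE[OF Q(2), of M]) (rule that)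
  show ?thesis
  proof (rule class_LinfI[where M = "\<bar>Q 0 0\<bar> + L * (M + M)"])
    fix t :: real assume t: "t \<ge> 0"
    show "(\<lambda>x. Q (a x t) (b x t)) \<in> borel_measurable lebesgue"
      by (rule borel_measurable_compose2[OF Q(1) ab t])
    show "AE x in lebesgue. \<bar>Q (a x t) (b x t)\<bar> \<le> \<bar>Q 0 0\<bar> + L * (M + M)"
      using M[OF t]
    proof eventually_elim
      case (elim x)
      then have "\<bar>Q (a x t) (b x t) - Q 0 0\<bar> \<le> L * (\<bar>a x t - 0\<bar> + \<bar>b x t - 0\<bar>)" by (intro L(2)) auto
      also have "\<dots> \<le> L * (M + M)" using elim L(1) by (intro mult_left_mono) auto
      finally show ?case by linarith
    qed
  qed
qed

lemma class_Sp_abs: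
  assumes "class_Sp F"
  shows "class_Sp (\<lambda>x t. \<bar>F x t\<bar>)"
  by (rule class_Sp_dominated[OF assms, where K = 1])
    (auto intro: borel_measurable_abs class_Sp_measurable[OF assms])

lemma class_Sp_compose2_diff:
  assumes Q: "case_prod Q \<in> borel_measurable (borel \<Otimes>\<^sub>M borel)" "box_Lipschitz Q"
    and Linf: "class_Linf a" "class_Linf b" "class_Linf c" "class_Linf d" "class_Linf z"
    and Sp: "class_Sp (\<lambda>x t. (a x t - c x t) * z x t)" "class_Sp (\<lambda>x t. (b x t - d x t) * z x t)"
  shows "class_Sp (\<lambda>x t. (Q (a x t) (b x t) - Q (c x t) (d x t)) * z x t)"
proof -
  obtain M where M: "\<And>t. t \<ge> 0 \<Longrightarrow>
      AE x in lebesgue. \<bar>a x t\<bar> \<le> M \<and> \<bar>b x t\<bar> \<le> M \<and> \<bar>c x t\<bar> \<le> M \<and> \<bar>d x t\<bar> \<le> M"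
    by (rule AE_abs_le_common_bound[OF Linf(1-4)]) (rule that)
  obtain L where L: "L \<ge> 0" "\<And>a b c d. \<bar>a\<bar> \<le> M \<Longrightarrow> \<bar>b\<bar> \<le> M \<Longrightarrow> \<bar>c\<bar> \<le> M \<Longrightarrow> \<bar>d\<bar> \<le> M \<Longrightarrow>
      \<bar>Q a b - Q c d\<bar> \<le> L * (\<bar>a - c\<bar> + \<bar>b - d\<bar>)"
    by (rule box_LipschitzE[OF Q(2), of M]) (rule that)
  show ?thesis
  proof (rule class_Sp_dominated[OF class_Sp_add[OF Sp[THEN class_Sp_abs]], where K = L])
    fix t :: real assume t: "t \<ge> 0"
    show "(\<lambda>x. (Q (a x t) (b x t) - Q (c x t) (d x t)) * z x t) \<in> borel_measurable lebesgue"
      by (intro borel_measurable_times borel_measurable_diff borel_measurable_compose2[OF Q(1) Linf(1,2) t]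
          borel_measurable_compose2[OF Q(1) Linf(3,4) t] class_Linf_measurable[OF Linf(5) t])
    show "AE x in lebesgue. \<bar>(Q (a x t) (b x t) - Q (c x t) (d x t)) * z x t\<bar>
        \<le> L * \<bar>\<bar>(a x t - c x t) * z x t\<bar> + \<bar>(b x t - d x t) * z x t\<bar>\<bar>"
      using M[OF t]
    proof eventually_elim
      case (elim x)
      then have "\<bar>Q (a x t) (b x t) - Q (c x t) (d x t)\<bar> * \<bar>z x t\<bar>
          \<le> L * (\<bar>a x t - c x t\<bar> + \<bar>b x t - d x t\<bar>) * \<bar>z x t\<bar>"
        by (intro mult_right_mono L(2)) auto
      then show ?case by (simp add: abs_mult distrib_left distrib_right mult.assoc)
    qed
  qed
qed

lemma interpolates_compose2:
  assumes Q: "case_prod Q \<in> borel_measurable (borel \<Otimes>\<^sub>M borel)" "box_Lipschitz Q"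
    and Linf: "class_Linf w" "class_Linf a" "class_Linf am" "class_Linf ap"
      "class_Linf b" "class_Linf bm" "class_Linf bp"
    and ip: "interpolates w a am ap" "interpolates w b bm bp"
  shows "interpolates w (\<lambda>x t. Q (a x t) (b x t)) (\<lambda>x t. Q (am x t) (bm x t)) (\<lambda>x t. Q (ap x t) (bp x t))"
  unfolding interpolates_def
proof
  have sp: "class_Sp (\<lambda>x t. (a x t - am x t) * (1 - w x t))" "class_Sp (\<lambda>x t. (a x t - ap x t) * w x t)"
      "class_Sp (\<lambda>x t. (b x t - bm x t) * (1 - w x t))" "class_Sp (\<lambda>x t. (b x t - bp x t) * w x t)"
    using ip unfolding interpolates_def by simp_all
  have "class_Linf (\<lambda>x t. 1 - w x t)" by (rule class_Linf_diff[OF class_Linf_const Linf(1)])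
  then show "class_Sp (\<lambda>x t. (Q (a x t) (b x t) - Q (am x t) (bm x t)) * (1 - w x t))"
    by (rule class_Sp_compose2_diff[OF Q Linf(2,5,3,6) _ sp(1,3)])
  show "class_Sp (\<lambda>x t. (Q (a x t) (b x t) - Q (ap x t) (bp x t)) * w x t)"
    by (rule class_Sp_compose2_diff[OF Q Linf(2,5,4,7,1) sp(2,4)])
qed

lemma weight_Linf:
  assumes "weight_family G" "g \<in> G"
  shows "class_Linf g"
proof -
  have xd: "x_differentiable g" and "\<exists>M. \<forall>x. \<forall>t\<ge>0. \<bar>g x t\<bar> \<le> M"
    using assms unfolding weight_family_def by simp_all
  then obtain M where M: "\<And>x t. t \<ge> 0 \<Longrightarrow> \<bar>g x t\<bar> \<le> M" by blast
  show ?thesis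
  proof (rule class_LinfI[where M = M])
    fix t :: real assume t: "t \<ge> 0"
    then have "\<And>x. isCont (\<lambda>y. g y t) x"
      using xd unfolding x_differentiable_def by (simp add: differentiable_imp_continuous_within)
    then have "(\<lambda>x. g x t) \<in> borel_measurable borel"
      by (intro borel_measurable_continuous_onI continuous_at_imp_continuous_on) auto
    then show "(\<lambda>x. g x t) \<in> borel_measurable lebesgue" by (intro measurable_completion) simp
    show "AE x in lebesgue. \<bar>g x t\<bar> \<le> M" using M[OF t] by simp
  qed
qed

lemma weight_Sp:
  assumes "weight_family G" "g \<in> G" "h \<in> G"
  shows "class_Sp (\<lambda>x t. (1 - g x t) * h x t)" "class_Sp (\<lambda>x t. g x t - h x t)"
  using assms unfolding weight_family_def by auto

lemma abs_le_if_closed_segment: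
  fixes a b y :: real
  assumes "y \<in> closed_segment a b"
  shows "\<bar>y\<bar> \<le> \<bar>a\<bar> + \<bar>b\<bar>"
  using assms by (auto simp: closed_segment_eq_real_ivl split: if_splits)

lemma perturbed_profile:
  fixes c d :: real
  assumes nu: "\<nu> > 0" and al: "\<alpha> > 0" and G: "weight_family G"
    and vm: "class_Ti \<nu> \<alpha> vm" and vp: "class_Ti \<nu> \<alpha> vp"
    and cd: "c \<noteq> d" and g0: "(\<lambda>x t. (us x t - c) / (d - c)) \<in> G"
    and g: "g \<in> G" and w: "w \<in> G"
    and conn: "connects ush (\<lambda>x t. c + vm x t) (\<lambda>x t. d + vp x t)"
    and E: "class_R \<nu> \<alpha> (\<lambda>x t. ush x t - us x t - vm x t * (1 - g x t) - vp x t * g x t)"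
  shows "class_Linf us" "class_Linf ush"
    "interpolates w us (\<lambda>x t. c) (\<lambda>x t. d)"
    "interpolates w ush (\<lambda>x t. c + vm x t) (\<lambda>x t. d + vp x t)"
    "class_R \<nu> \<alpha> (\<lambda>x t. ush x t - us x t - vm x t * (1 - w x t) - vp x t * w x t)"
proof -
  define g0 where "g0 x t = (us x t - c) / (d - c)" for x t
  have g0G: "g0 \<in> G" using g0 unfolding g0_def .
  have us: "us = (\<lambda>x t. c + (d - c) * g0 x t)" using cd by (auto simp: g0_def fun_eq_iff)
  have Linf: "class_Linf g0" "class_Linf g" "class_Linf w" "class_Linf vm" "class_Linf vp"
    using weight_Linf[OF G] g0G g w class_Ti_imp_Linf[OF nu al] vm vp by auto
  show usL: "class_Linf us"
    unfolding us by (intro class_Linf_add class_Linf_mult class_Linf_const Linf)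
  define e where "e x t = ush x t - us x t - vm x t * (1 - g x t) - vp x t * g x t" for x t
  have eSp: "class_Sp e" using class_R_imp_Sp[OF nu al E] unfolding e_def .
  have ush: "ush = (\<lambda>x t. us x t + vm x t * (1 - g x t) + vp x t * g x t + e x t)"
    by (simp add: e_def fun_eq_iff)
  have um: "class_Linf (\<lambda>x t. c + vm x t)" and up: "class_Linf (\<lambda>x t. d + vp x t)"
    by (intro class_Linf_add class_Linf_const Linf)+
  obtain A where A: "\<And>t. t \<ge> 0 \<Longrightarrow> AE x in lebesgue. \<bar>c + vm x t\<bar> \<le> A"
    using um by (rule class_LinfE) blast
  obtain B where B: "\<And>t. t \<ge> 0 \<Longrightarrow> AE x in lebesgue. \<bar>d + vp x t\<bar> \<le> B"
    using up by (rule class_LinfE) blast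
  show "class_Linf ush"
  proof (rule class_LinfI[where M = "A + B"])
    fix t :: real assume t: "t \<ge> 0"
    show "(\<lambda>x. ush x t) \<in> borel_measurable lebesgue"
      unfolding ush using t
      by (intro borel_measurable_add borel_measurable_times borel_measurable_diff borel_measurable_const
          class_Linf_measurable class_Sp_measurable usL Linf eSp)
    show "AE x in lebesgue. \<bar>ush x t\<bar> \<le> A + B"
      using A[OF t] B[OF t]
    proof eventually_elim
      case (elim x)
      have "ush x t \<in> closed_segment (c + vm x t) (d + vp x t)"
        using conn t unfolding connects_def by blast
      from abs_le_if_closed_segment[OF this] elim show ?case by linarith
    qed
  qed
  have Sp: "class_Sp (\<lambda>x t. (1 - w x t) * g0 x t)" "class_Sp (\<lambda>x t. (1 - w x t) * g x t)"
      "class_Sp (\<lambda>x t. (1 - g0 x t) * w x t)" "class_Sp (\<lambda>x t. (1 - g x t) * w x t)"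
    by (intro weight_Sp[OF G] g g0G w)+
  show "interpolates w us (\<lambda>x t. c) (\<lambda>x t. d)"
    unfolding interpolates_def
  proof
    show "class_Sp (\<lambda>x t. (us x t - c) * (1 - w x t))"
      by (rule class_Sp_cong[OF class_Sp_Linf_mult[OF class_Linf_const[of "d - c"] Sp(1)]])
        (simp add: us)
    show "class_Sp (\<lambda>x t. (us x t - d) * w x t)"
      by (rule class_Sp_cong[OF class_Sp_Linf_mult[OF class_Linf_const[of "c - d"] Sp(3)]])
        (simp add: us algebra_simps)
  qed
  show "interpolates w ush (\<lambda>x t. c + vm x t) (\<lambda>x t. d + vp x t)"
    unfolding interpolates_def
  proof
    have "class_Sp (\<lambda>x t. (d - c) * ((1 - w x t) * g0 x t)
        + ((vp x t - vm x t) * ((1 - w x t) * g x t) + (1 - w x t) * e x t))"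
      by (intro class_Sp_add class_Sp_Linf_mult class_Linf_diff class_Linf_const Linf Sp eSp)
    then show "class_Sp (\<lambda>x t. (ush x t - (c + vm x t)) * (1 - w x t))"
      by (rule class_Sp_cong) (simp add: us ush algebra_simps)
    have "class_Sp (\<lambda>x t. (c - d) * ((1 - g0 x t) * w x t)
        + ((vm x t - vp x t) * ((1 - g x t) * w x t) + w x t * e x t))"
      by (intro class_Sp_add class_Sp_Linf_mult class_Linf_diff class_Linf_const Linf Sp eSp)
    then show "class_Sp (\<lambda>x t. (ush x t - (d + vp x t)) * w x t)"
      by (rule class_Sp_cong) (simp add: us ush algebra_simps)
  qed
  have "class_R \<nu> \<alpha> (\<lambda>x t. (ush x t - us x t - vm x t * (1 - g x t) - vp x t * g x t)
      + (vp x t - vm x t) * (g x t - w x t))"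
    by (intro class_R_add class_R_Ti_Sp_mult class_Ti_diff weight_Sp[OF G] nu vm vp E g w)
  then show "class_R \<nu> \<alpha> (\<lambda>x t. ush x t - us x t - vm x t * (1 - w x t) - vp x t * w x t)"
    by (rule class_R_cong) (simp add: algebra_simps)
qed

lemma x_differentiable_DERIV:
  "x_differentiable F \<Longrightarrow> t \<ge> 0 \<Longrightarrow> ((\<lambda>y. F y t) has_real_derivative dx F x t) (at x)"
  unfolding x_differentiable_def dx_def by (simp add: DERIV_deriv_iff_real_differentiable)

theorem lemma2p4:
  fixes \<nu> \<alpha> :: real
    and ubm ubp nbm nbp :: real
    and vm vp rm rp um up nm np :: "real \<Rightarrow> real \<Rightarrow> real"
    and ustar nstar ush nsh :: "real \<Rightarrow> real \<Rightarrow> real"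
    and G :: "(real \<Rightarrow> real \<Rightarrow> real) set"
    and g gt g1 :: "real \<Rightarrow> real \<Rightarrow> real"
  assumes "\<nu> > 0" and "\<alpha> > 0"
    and "weight_family G"
    and "perturbation \<nu> \<alpha> vm" and "perturbation \<nu> \<alpha> vp"
    and "perturbation \<nu> \<alpha> rm" and "perturbation \<nu> \<alpha> rp"
    and "um = (\<lambda>x t. ubm + vm x t)" and "up = (\<lambda>x t. ubp + vp x t)"
    and "nm = (\<lambda>x t. nbm + rm x t)" and "np = (\<lambda>x t. nbp + rp x t)"
    and "connects ustar (\<lambda>x t. ubm) (\<lambda>x t. ubp)"
    and "connects nstar (\<lambda>x t. nbm) (\<lambda>x t. nbp)"
    and "connects ush um up"
    and "connects nsh nm np"
    and "ubm \<noteq> ubp" and "nbm \<noteq> nbp"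
    and "(\<lambda>x t. (ustar x t - ubm) / (ubp - ubm)) \<in> G"
    and "(\<lambda>x t. (nstar x t - nbm) / (nbp - nbm)) \<in> G"
    and "g \<in> G" and "gt \<in> G" and "g1 \<in> G"
    and "class_R \<nu> \<alpha>
           (\<lambda>x t. ush x t - ustar x t - vm x t * (1 - g x t) - vp x t * g x t)"
    and "class_R \<nu> \<alpha>
           (\<lambda>x t. nsh x t - nstar x t - rm x t * (1 - gt x t) - rp x t * gt x t)"
  shows
    "(\<forall>f. C2_function f \<longrightarrow>
        class_R \<nu> \<alpha>
          (\<lambda>x t. f (ush x t) - f (ustar x t)
                  - (f (um x t) - f ubm) * (1 - g1 x t)
                  - (f (up x t) - f ubp) * g1 x t) \<and>
        class_Sp
          (\<lambda>x t. f (ush x t) - f (um x t) * (1 - g1 x t) - f (up x t) * g1 x t) \<and>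
        (f ubm \<noteq> f ubp \<and>
         (\<forall>x. \<forall>t\<ge>0. g1 x t = (f (ustar x t) - f ubm) / (f ubp - f ubm)) \<longrightarrow>
         class_R \<nu> \<alpha>
           (\<lambda>x t. f (ush x t) - f (um x t) * (1 - g1 x t) - f (up x t) * g1 x t)))
     \<and>
     (let E = (\<lambda>x t. ush x t - ustar x t - vm x t * (1 - g x t) - vp x t * g x t)
      in x_differentiable E \<and> class_R \<nu> \<alpha> (dx E) \<longrightarrow>
         class_R \<nu> \<alpha>
           (\<lambda>x t. dx ush x t - dx ustar x t
                   - dx um x t * (1 - g1 x t) - dx up x t * g1 x t))
     \<and>
     (\<forall>a b :: real.
        class_R \<nu> \<alpha>
          (\<lambda>x t. a * nsh x t + b * ush x t - a * nstar x t - b * ustar x t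
                  - (a * rm x t + b * vm x t) * (1 - g1 x t)
                  - (a * rp x t + b * vp x t) * g1 x t))
     \<and>
     class_R \<nu> \<alpha>
       (\<lambda>x t. nsh x t * ush x t - nstar x t * ustar x t
               - (nm x t * um x t - nbm * ubm) * (1 - g1 x t)
               - (np x t * up x t - nbp * ubp) * g1 x t)"
proof -
  note nu = assms(1) and al = assms(2) and G = assms(3)
  note um = assms(8) and up = assms(9) and nm = assms(10) and np = assms(11)
  have v: "x_differentiable vm" "class_Ti \<nu> \<alpha> vm" "class_Ti \<nu> \<alpha> (dx vm)"
      "x_differentiable vp" "class_Ti \<nu> \<alpha> vp" "class_Ti \<nu> \<alpha> (dx vp)"
    and r: "class_Ti \<nu> \<alpha> rm" "class_Ti \<nu> \<alpha> rp"
    using assms(4-7) unfolding perturbation_def by auto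
  note U = perturbed_profile[OF nu al G v(2,5) assms(16,18,20,22) assms(14)[unfolded um up] assms(23),
      folded um up]
  note N = perturbed_profile[OF nu al G r assms(17,19,21,22) assms(15)[unfolded nm np] assms(24),
      folded nm np]
  have w: "class_Linf g1" by (rule weight_Linf[OF G assms(22)])
  have L: "class_Linf um" "class_Linf up"
    unfolding um up by (intro class_Linf_add class_Linf_const class_Ti_imp_Linf[OF nu al] v)+

  have "class_R \<nu> \<alpha> (\<lambda>x t. f (ush x t) - f (ustar x t)
                  - (f (um x t) - f ubm) * (1 - g1 x t) - (f (up x t) - f ubp) * g1 x t)" (is ?i1)
    and "class_Sp (\<lambda>x t. f (ush x t) - f (um x t) * (1 - g1 x t) - f (up x t) * g1 x t)" (is ?i2)
    if "C2_function f" for f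
  proof -
    obtain Q where Q: "case_prod Q \<in> borel_measurable (borel \<Otimes>\<^sub>M borel)" "box_Lipschitz Q"
      and fQ: "\<And>a b. f a - f b = Q a b * (a - b)"
      by (rule C2_divided_difference[OF \<open>C2_function f\<close>]) (rule that)
    have "class_R \<nu> \<alpha> (\<lambda>x t. Q (ush x t) (ustar x t) * (ush x t - ustar x t)
        - Q (um x t) ubm * vm x t * (1 - g1 x t) - Q (up x t) ubp * vp x t * g1 x t)"
      using interpolates_compose2[OF Q w U(2) L U(1) class_Linf_const class_Linf_const U(4,3)]
      by (rule class_R_interpolates_mult[OF nu class_Linf_compose2[OF Q U(2,1)] _ v(2,5) U(5)])
    then show ?i1 by (rule class_R_cong) (simp add: fQ um up)
    have "interpolates g1 (\<lambda>x t. f (ush x t)) (\<lambda>x t. f (um x t)) (\<lambda>x t. f (up x t))"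
      using class_Sp_Linf_mult[OF class_Linf_compose2[OF Q U(2) L(1)] conjunct1[OF U(4)[unfolded interpolates_def]]]
        class_Sp_Linf_mult[OF class_Linf_compose2[OF Q U(2) L(2)] conjunct2[OF U(4)[unfolded interpolates_def]]]
      unfolding interpolates_def fQ mult.assoc by (rule conjI)
    then show ?i2 by (rule interpolates_imp_Sp)
  qed
  note i1 = this(1) and i2 = this(2)

  have i3: "class_R \<nu> \<alpha> (\<lambda>x t. f (ush x t) - f (um x t) * (1 - g1 x t) - f (up x t) * g1 x t)"
    if "C2_function f" and ne: "f ubm \<noteq> f ubp"
      and eq: "\<forall>x. \<forall>t\<ge>0. g1 x t = (f (ustar x t) - f ubm) / (f ubp - f ubm)" for f
  proof (rule class_R_cong[OF i1[OF \<open>C2_function f\<close>]])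
    fix x t :: real assume "t \<ge> 0"
    then have "f (ustar x t) = f ubm + (f ubp - f ubm) * g1 x t" using ne eq by simp
    then show "f (ush x t) - f (um x t) * (1 - g1 x t) - f (up x t) * g1 x t
        = f (ush x t) - f (ustar x t) - (f (um x t) - f ubm) * (1 - g1 x t) - (f (up x t) - f ubp) * g1 x t"
      by (simp add: algebra_simps)
  qed

  define E where "E x t = ush x t - ustar x t - vm x t * (1 - g x t) - vp x t * g x t" for x t
  have ii: "class_R \<nu> \<alpha> (\<lambda>x t. dx ush x t - dx ustar x t - dx um x t * (1 - g1 x t) - dx up x t * g1 x t)"
    if E: "x_differentiable E" "class_R \<nu> \<alpha> (dx E)"
  proof -
    define g0 where "g0 x t = (ustar x t - ubm) / (ubp - ubm)" for x t
    have g0: "g0 \<in> G" using assms(18) unfolding g0_def .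
    have us: "ustar = (\<lambda>x t. ubm + (ubp - ubm) * g0 x t)"
      using assms(16) by (auto simp: g0_def fun_eq_iff)
    have ush: "ush = (\<lambda>x t. ustar x t + vm x t * (1 - g x t) + vp x t * g x t + E x t)"
      by (simp add: E_def fun_eq_iff)
    have dG: "x_differentiable g" "x_differentiable g0" and Sp_dg: "class_Sp (dx g)"
      using G assms(20) g0 unfolding weight_family_def by auto
    have "class_R \<nu> \<alpha> (\<lambda>x t. (dx vp x t - dx vm x t) * (g x t - g1 x t)
        + ((vp x t - vm x t) * dx g x t + dx E x t))"
      by (intro class_R_add class_R_Ti_Sp_mult class_Ti_diff weight_Sp[OF G] Sp_dg nu v E assms(20,22))
    then show ?thesis
    proof (rule class_R_cong)
      fix x t :: real assume t: "t \<ge> 0"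
      note d = x_differentiable_DERIV[OF _ t]
      have dus: "((\<lambda>y. ustar y t) has_real_derivative (ubp - ubm) * dx g0 x t) (at x)"
        unfolding us by (auto intro!: derivative_eq_intros d dG)
      have "((\<lambda>y. ush y t) has_real_derivative (ubp - ubm) * dx g0 x t
          + (dx vm x t * (1 - g x t) - vm x t * dx g x t) + (dx vp x t * g x t + vp x t * dx g x t)
          + dx E x t) (at x)"
        unfolding ush by (auto intro!: derivative_eq_intros d dG v E dus simp: algebra_simps)
      moreover have "((\<lambda>y. um y t) has_real_derivative dx vm x t) (at x)"
        "((\<lambda>y. up y t) has_real_derivative dx vp x t) (at x)"
        unfolding um up by (auto intro!: derivative_eq_intros d v)
      ultimately have "dx ush x t = (ubp - ubm) * dx g0 x t
          + (dx vm x t * (1 - g x t) - vm x t * dx g x t) + (dx vp x t * g x t + vp x t * dx g x t) + dx E x t"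
        "dx ustar x t = (ubp - ubm) * dx g0 x t" "dx um x t = dx vm x t" "dx up x t = dx vp x t"
        using dus by (simp_all add: dx_def[of ush] dx_def[of ustar] dx_def[of um] dx_def[of up] DERIV_imp_deriv)
      then show "dx ush x t - dx ustar x t - dx um x t * (1 - g1 x t) - dx up x t * g1 x t
          = (dx vp x t - dx vm x t) * (g x t - g1 x t) + ((vp x t - vm x t) * dx g x t + dx E x t)"
        by (simp add: algebra_simps)
    qed
  qed

  have iii_lin: "class_R \<nu> \<alpha> (\<lambda>x t. a * nsh x t + b * ush x t - a * nstar x t - b * ustar x t
                  - (a * rm x t + b * vm x t) * (1 - g1 x t) - (a * rp x t + b * vp x t) * g1 x t)"
    for a b :: real
    by (rule class_R_cong[OF class_R_add[OF nu
            class_R_Linf_mult[OF nu class_Linf_const[of a] N(5)]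
            class_R_Linf_mult[OF nu class_Linf_const[of b] U(5)]]])
      (simp add: algebra_simps)

  have iii_prod: "class_R \<nu> \<alpha> (\<lambda>x t. nsh x t * ush x t - nstar x t * ustar x t
      - (nm x t * um x t - nbm * ubm) * (1 - g1 x t) - (np x t * up x t - nbp * ubp) * g1 x t)"
    by (rule class_R_cong[OF class_R_add[OF nu
            class_R_interpolates_mult[OF nu U(2) U(4) r N(5)]
            class_R_interpolates_mult[OF nu N(1) N(3) v(2,5) U(5)]]])
      (simp add: um up nm np algebra_simps)

  show ?thesis
    using i1 i2 i3 ii iii_lin iii_prod unfolding Let_def E_def by blast
qed

end
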